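(* For any integer $d>2$, any $0<\varepsilon<1/2$, and any $0<\delta<\sqrt{d/2-1}$, there is an origin-symmetric convex body $K\subseteq C=[-1,1]^d$ in $\mathbb{R}^d$ with $\mathrm{r}(K)=\sqrt{1+\delta^2}$ whose maximum volume inscribed ellipsoid is $B_2^d$, and there are (for some positive integer $m$) points $u_1,\ldots,u_m\in\mathrm{bd}(K)\cap\mathrm{bd}(C)$ and $v_1,\ldots,v_m\in\mathrm{bd}(K^\circ)\cap\mathrm{bd}(C^\circ)$ satisfying $$\frac1d I=\sum_{i=1}^m\alpha_i\,u_i\otimes v_i\quad\text{for some scalars }\alpha_1,\ldots,\alpha_m>0\text{ with }\sum_{i=1}^m\alpha_i=1,$$ with the following property. If $M\subset[m]$ is a subset such that $$\left\|\sum_{i\in M}\beta_i\,u_i\otimes v_i-I\right\|\leq\varepsilon$$ for some scalars $\beta_i\in\mathbb{R}$ ($i\in M$), then $$|M|\geq d\,\min\left\{\frac d4,\left(\frac{\delta}{4\varepsilon}\right)^2\right\}.$$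
   Context: $[m]=\{1,\ldots,m\}$. $B_2^d$ is the closed Euclidean unit ball of $\mathbb{R}^d$ centered at the origin, $I$ is the identity operator on $\mathbb{R}^d$, $\mathrm{bd}$ denotes the boundary, and $\|\cdot\|$ is the operator norm induced by the Euclidean norm. For $u,v\in\mathbb{R}^d$, $u\otimes v$ is the linear operator $(u\otimes v)x=\langle u,x\rangle v$. The polar of a convex body $K$ is $K^\circ=\{x:\langle x,y\rangle\leq1\text{ for every }y\in K\}$. The Banach--Mazur distance of a convex body $K$ to the Euclidean ball is $$\mathrm{r}(K)=\inf\{\lambda:\ \mathcal{E}\subset K-a\subset\lambda\mathcal{E}\text{ for some ellipsoid }\mathcal{E}\text{ and vector }a\text{ in }\mathbb{R}^d\},$$ where ellipsoids $\mathcal{E}$ here are centered at the origin. Every convex body contains a unique ellipsoid of maximum volume, called its maximum volume inscribed ellipsoid. *)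

theory Defs
  imports "HOL-Analysis.Analysis"
begin

definition convex_body :: "'a::euclidean_space set \<Rightarrow> bool" where
  "convex_body K \<longleftrightarrow> convex K \<and> compact K \<and> interior K \<noteq> {}"

definition origin_symmetric :: "'a::euclidean_space set \<Rightarrow> bool" where
  "origin_symmetric K \<longleftrightarrow> uminus ` K = K"

definition polar :: "'a::euclidean_space set \<Rightarrow> 'a set" where
  "polar K = {x. \<forall>y\<in>K. x \<bullet> y \<le> 1}"

definition cube :: "(real ^ 'n) set" where
  "cube = {x. \<forall>i. -1 \<le> x $ i \<and> x $ i \<le> 1}"

definition centered_ellipsoid :: "'a::euclidean_space set \<Rightarrow> bool" where
  "centered_ellipsoid E \<longleftrightarrow> (\<exists>f :: 'a \<Rightarrow> 'a. linear f \<and> bij f \<and> E = f ` cball 0 1)"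

definition ellipsoid :: "'a::euclidean_space set \<Rightarrow> bool" where
  "ellipsoid E \<longleftrightarrow> (\<exists>E0 c. centered_ellipsoid E0 \<and> E = (\<lambda>x. x + c) ` E0)"

(* The constraint 0 < l is needed: since E = -E, a negative l would otherwise be
   admissible whenever its absolute value is, and the set would be unbounded below. *)
definition BM_dist_ball :: "'a::euclidean_space set \<Rightarrow> real" where
  "BM_dist_ball K = Inf {l. 0 < l \<and>
     (\<exists>E a. centered_ellipsoid E \<and> E \<subseteq> (\<lambda>x. x - a) ` K \<and> (\<lambda>x. x - a) ` K \<subseteq> (\<lambda>x. l *\<^sub>R x) ` E)}"

(* Ellipsoids inscribed in K may have any center. The strict inequality says that E is
   the unique inscribed ellipsoid of maximum volume. *)
definition is_max_volume_ellipsoid :: "'a::euclidean_space set \<Rightarrow> 'a set \<Rightarrow> bool" where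
  "is_max_volume_ellipsoid E K \<longleftrightarrow> ellipsoid E \<and> E \<subseteq> K \<and>
     (\<forall>E'. ellipsoid E' \<and> E' \<subseteq> K \<and> E' \<noteq> E \<longrightarrow> measure lebesgue E' < measure lebesgue E)"

definition tensor_op :: "'a::euclidean_space \<Rightarrow> 'a \<Rightarrow> 'a \<Rightarrow> 'a" (infix "\<otimes>\<^sub>o" 75) where
  "(u \<otimes>\<^sub>o v) = (\<lambda>x. (u \<bullet> x) *\<^sub>R v)"

end

theory Submission
  imports Defs
begin

text \<open>
  Let \<open>K\<close> be the intersection of the cube with the ball of radius \<open>r = sqrt (1 + \<delta>\<^sup>2)\<close>. If an ellipsoid
  \<open>f B\<close> has a translate inside the cube, then the rows of \<open>f\<close> have norm at most 1. By Hadamard's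
  inequality and its equality case the unit ball is the unique ellipsoid of maximum volume. If
  moreover \<open>K - a\<close> lies in \<open>l f B\<close>, then the points of \<open>K\<close> with coordinates \<open>\<plusminus>r / sqrt d\<close> are mapped by the
  inverse of \<open>f\<close> into \<open>l B\<close>, and choosing the signs so that cross terms do not hurt yields \<open>r \<le> l\<close>.

  For \<open>N = 2^p\<close> with \<open>d/2 < N \<le> d\<close>, the contact points are \<open>e\<^sub>j + w\<close> (paired with \<open>e\<^sub>j\<close>), where \<open>w\<close>
  runs over the vertices of a regular simplex with \<open>N\<close> vertices and circumradius \<open>\<delta>\<close>, orthogonal to \<open>e\<^sub>j\<close>.
  The vertices are scaled columns of a Sylvester matrix without its constant row, so their coordinates
  stay in \<open>[-1, 1]\<close>. If \<open>M\<close> is too small, some \<open>j\<close> is paired with few points of \<open>M\<close>; the \<open>j\<close>-th row of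
  the operator then shows that some affine combination of few vertices of the simplex is close to its
  centre, which is impossible.
\<close>

section \<open>Sylvester matrices and a choice of signs\<close>

text \<open>Doubling \<open>H\<close> to the block matrix with \<open>H\<close>, \<open>H\<close>
  above and \<open>H\<close>, \<open>-H\<close> below keeps the columns orthogonal and row 0
  constant. Deleting that row leaves the vertices of a regular simplex.\<close>

lemma sylvester_matrix_exists:
  "\<exists>H :: nat \<Rightarrow> nat \<Rightarrow> real. (\<forall>a<2^p. \<forall>k<2^p. \<bar>H a k\<bar> = 1) \<and> (\<forall>k<2^p. H 0 k = 1) \<and>
     (\<forall>k<2^p. \<forall>l<2^p. (\<Sum>a<2^p. H a k * H a l) = (if k = l then 2^p else 0))"
proof (induction p)
  case 0
  show ?case by (rule exI[of _ "\<lambda>_ _. 1"]) auto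
next
  case (Suc p)
  define N :: nat where "N = 2^p"
  obtain H :: "nat \<Rightarrow> nat \<Rightarrow> real" where
    abs: "\<And>a k. a < N \<Longrightarrow> k < N \<Longrightarrow> \<bar>H a k\<bar> = 1" and row0: "\<And>k. k < N \<Longrightarrow> H 0 k = 1" and
    orth: "\<And>k l. k < N \<Longrightarrow> l < N \<Longrightarrow> (\<Sum>a<N. H a k * H a l) = (if k = l then real N else 0)"
    using Suc.IH unfolding N_def by force
  have N0: "N > 0" by (simp add: N_def)
  have N2: "2 ^ Suc p = N + N" by (simp add: N_def)
  define G where "G a k = (if a < N then H a (k mod N)
      else (if k < N then 1 else -1) * H (a - N) (k mod N))" for a k
  have split: "(\<Sum>a<N+N. f a) = (\<Sum>a<N. f a) + (\<Sum>a<N. f (N + a))" for f :: "nat \<Rightarrow> real"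
    using sum.atLeastLessThan_concat[of 0 N "N+N" f] sum.shift_bounds_nat_ivl[of f 0 N N]
    by (simp add: lessThan_atLeast0 add.commute)
  have kmod: "k mod N < N" for k using N0 by simp
  have "(\<Sum>a<N+N. G a k * G a l) = (if k = l then real (N + N) else 0)"
    if k: "k < N + N" and l: "l < N + N" for k l
  proof -
    let ?s = "\<lambda>k. (if k < N then 1 else -1) :: real"
    have "(\<Sum>a<N+N. G a k * G a l)
        = (1 + ?s k * ?s l) * (\<Sum>a<N. H a (k mod N) * H a (l mod N))"
      unfolding split by (simp add: G_def sum_distrib_left sum.distrib[symmetric] algebra_simps)
    also have "\<dots> = (1 + ?s k * ?s l) * (if k mod N = l mod N then real N else 0)"
      using orth[OF kmod kmod] by simp
    \<comment> \<open>Distinct \<open>k\<close>, \<open>l\<close> with the same residue lie in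
      different halves, so the factor \<open>1 + ?s k * ?s l\<close> vanishes; for
      \<open>k = l\<close> it is 2.\<close>
    also have "\<dots> = (if k = l then real (N + N) else 0)"
      using k l by (auto simp: mod_if split: if_splits)
    finally show ?thesis .
  qed
  moreover have "\<bar>G a k\<bar> = 1" if "a < N + N" for a k
    using that abs[OF _ kmod] by (auto simp: G_def abs_mult)
  moreover have "G 0 k = 1" for k using N0 row0[OF kmod] by (simp add: G_def)
  ultimately show ?case unfolding N2 of_nat_power[symmetric]
    by (intro exI[of _ G]) (use N2 in \<open>auto simp: N_def\<close>)
qed

text \<open>Signs are chosen greedily: each new term gets the sign that makes its inner product with
  the partial sum nonnegative, so cross terms never reduce the squared norm.\<close>

lemma signs_exist:
  fixes x :: "'i \<Rightarrow> 'a::real_inner"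
  assumes "finite A"
  shows "\<exists>s :: 'i \<Rightarrow> real. (\<forall>i. \<bar>s i\<bar> = 1) \<and> (\<Sum>i\<in>A. (norm (x i))\<^sup>2) \<le> (norm (\<Sum>i\<in>A. s i *\<^sub>R x i))\<^sup>2"
  using assms
proof (induction A rule: finite_induct)
  case empty
  show ?case by (rule exI[of _ "\<lambda>_. 1"]) auto
next
  case (insert j A)
  then obtain s :: "'i \<Rightarrow> real" where s: "\<forall>i. \<bar>s i\<bar> = 1"
    "(\<Sum>i\<in>A. (norm (x i))\<^sup>2) \<le> (norm (\<Sum>i\<in>A. s i *\<^sub>R x i))\<^sup>2" by blast
  define y where "y = (\<Sum>i\<in>A. s i *\<^sub>R x i)"
  define c :: real where "c = (if x j \<bullet> y \<ge> 0 then 1 else -1)"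
  define s' where "s' = s(j := c)"
  have "(\<Sum>i\<in>insert j A. s' i *\<^sub>R x i) = c *\<^sub>R x j + y"
    using insert.hyps by (auto simp: s'_def y_def intro!: sum.cong)
  moreover have "(norm (c *\<^sub>R x j + y))\<^sup>2 = (norm (x j))\<^sup>2 + 2 * \<bar>x j \<bullet> y\<bar> + (norm y)\<^sup>2"
    unfolding power2_norm_eq_inner by (auto simp: c_def algebra_simps inner_commute)
  ultimately show ?case
    using s insert.hyps by (intro exI[of _ s']) (auto simp: s'_def c_def y_def)
qed

section \<open>Hadamard's inequality and its equality case\<close>

lemma row_eq_nth: "row i A = A $ i"
  by (simp add: row_def vec_eq_iff)

text \<open>Subtracting from row \<open>i\<close> its projection onto row \<open>k\<close> keeps the
  determinant but shortens the row if the two are not orthogonal. Stretching it to unit length would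
  then exceed the maximum.\<close>

lemma hadamard_maximizer_orthogonal:
  fixes A :: "real ^ 'n ^ 'n"
  assumes A: "\<And>i. norm (A $ i) \<le> 1" and "det A \<noteq> 0"
    and max: "\<And>B :: real ^ 'n ^ 'n. (\<And>i. norm (B $ i) \<le> 1) \<Longrightarrow> \<bar>det B\<bar> \<le> \<bar>det A\<bar>"
    and "i \<noteq> k"
  shows "A $ i \<bullet> A $ k = 0"
proof (rule ccontr)
  assume ne: "A $ i \<bullet> A $ k \<noteq> 0"
  define c where "c = - (A $ i \<bullet> A $ k) / (A $ k \<bullet> A $ k)"
  define y where "y = A $ i + c *\<^sub>R A $ k"
  have Ak: "A $ k \<noteq> 0" using ne by auto
  have "det (\<chi> l. if l = i then row i A + c *s row k A else row l A) = det A"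
    by (rule det_row_operation[OF \<open>i \<noteq> k\<close>])
  then have dety: "det (\<chi> l. if l = i then y else A $ l) = det A"
    by (simp add: y_def row_eq_nth scalar_mult_eq_scaleR cong: if_cong)
  have "y \<noteq> 0"
  proof
    assume "y = 0"
    then have "det (\<chi> l. if l = i then y else A $ l) = 0"
      by (intro det_zero_row(2)[of i]) (simp add: row_eq_nth)
    with dety \<open>det A \<noteq> 0\<close> show False by simp
  qed
  have "y \<bullet> y = A $ i \<bullet> A $ i - (A $ i \<bullet> A $ k)\<^sup>2 / (A $ k \<bullet> A $ k)"
  proof -
    have "y \<bullet> y = A $ i \<bullet> A $ i + 2 * c * (A $ i \<bullet> A $ k) + c\<^sup>2 * (A $ k \<bullet> A $ k)"
      by (simp add: y_def inner_add_left inner_add_right inner_commute power2_eq_square)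
    with Ak show ?thesis by (simp add: c_def field_simps power2_eq_square)
  qed
  also have "\<dots> < A $ i \<bullet> A $ i" using ne Ak by simp
  also have "\<dots> \<le> 1" using A[of i] by (simp add: norm_le_square flip: power2_norm_eq_inner)
  finally have ny: "norm y < 1" by (simp add: norm_lt_square)
  define B where "B = (\<chi> l. if l = i then (1 / norm y) *s y else A $ l)"
  have "det B = (1 / norm y) * det A"
    unfolding B_def using det_row_mul[of i "1 / norm y" "\<lambda>_. y" "\<lambda>l. A $ l"] dety by simp
  moreover have "\<bar>det B\<bar> \<le> \<bar>det A\<bar>"
    by (rule max) (use A \<open>y \<noteq> 0\<close> in \<open>simp add: B_def scalar_mult_eq_scaleR\<close>)
  ultimately show False using \<open>det A \<noteq> 0\<close> ny \<open>y \<noteq> 0\<close>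
    by (simp add: abs_mult divide_le_eq)
qed

text \<open>\<open>A ** transpose A\<close> is the Gram matrix of the rows, here diagonal.\<close>

lemma det_row_orthogonal:
  fixes A :: "real ^ 'n ^ 'n"
  assumes "\<And>i k. i \<noteq> k \<Longrightarrow> A $ i \<bullet> A $ k = 0"
  shows "(det A)\<^sup>2 = (\<Prod>i\<in>UNIV. (norm (A $ i))\<^sup>2)"
proof -
  have comp: "(A ** transpose A) $ i $ k = A $ i \<bullet> A $ k" for i k
    by (simp add: matrix_matrix_mult_def transpose_def inner_vec_def)
  have "(det A)\<^sup>2 = det (A ** transpose A)"
    by (simp add: det_mul power2_eq_square)
  also have "\<dots> = (\<Prod>i\<in>UNIV. (A ** transpose A) $ i $ i)"
    by (rule det_diagonal) (simp add: comp assms)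
  finally show ?thesis by (simp add: comp power2_norm_eq_inner)
qed

text \<open>By compactness some \<open>X\<close> maximizes the absolute determinant; its rows are
  orthogonal, so the maximum is at most 1. Hence \<open>A\<close> is a maximizer too, with
  orthogonal rows, and the product of their norms reaches 1 only if each norm is 1.\<close>

lemma hadamard_rows_orthonormal:
  fixes A :: "real ^ 'n ^ 'n"
  assumes A: "\<And>i. norm (A $ i) \<le> 1" and det: "\<bar>det A\<bar> \<ge> 1"
  shows "orthogonal_matrix A"
proof -
  define S where "S = {B :: real ^ 'n ^ 'n. \<forall>i. norm (B $ i) \<le> 1}"
  have "closed S"
  proof -
    have "S = (\<Inter>i. {B. norm (B $ i) \<le> 1})" by (auto simp: S_def)
    then show ?thesis by (auto intro!: closed_INT closed_Collect_le continuous_intros)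
  qed
  moreover have "bounded S"
  proof (rule boundedI)
    fix B assume "B \<in> S"
    have "norm B \<le> (\<Sum>i\<in>UNIV. norm (B $ i))" unfolding norm_vec_def by (rule L2_set_le_sum) simp
    also have "\<dots> \<le> (\<Sum>i\<in>(UNIV::'n set). 1)" using \<open>B \<in> S\<close> by (intro sum_mono) (auto simp: S_def)
    finally show "norm B \<le> real CARD('n)" by simp
  qed
  ultimately have "compact S" by (simp add: compact_eq_bounded_closed)
  moreover have "continuous_on S (\<lambda>B. \<bar>det B\<bar>)"
    unfolding det_def by (intro continuous_intros)
  moreover have AS: "A \<in> S" using A by (simp add: S_def)
  ultimately obtain X where X: "X \<in> S" "\<And>B. B \<in> S \<Longrightarrow> \<bar>det B\<bar> \<le> \<bar>det X\<bar>"
    using continuous_attains_sup[of S "\<lambda>B. \<bar>det B\<bar>"] by blast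
  have X1: "\<bar>det X\<bar> \<ge> 1" using X(2)[OF AS] det by linarith
  have "X $ i \<bullet> X $ k = 0" if "i \<noteq> k" for i k
    by (rule hadamard_maximizer_orthogonal[OF _ _ _ that]) (use X X1 in \<open>auto simp: S_def\<close>)
  then have "(det X)\<^sup>2 = (\<Prod>i\<in>UNIV. (norm (X $ i))\<^sup>2)" by (rule det_row_orthogonal)
  also have "\<dots> \<le> 1" using X(1) by (intro prod_le_1) (auto simp: S_def power_le_one)
  finally have "\<bar>det X\<bar> \<le> 1" by (simp add: abs_square_le_1)
  then have Amax: "\<bar>det B\<bar> \<le> \<bar>det A\<bar>" if "B \<in> S" for B using X(2)[OF that] det by linarith
  have orth: "A $ i \<bullet> A $ k = 0" if "i \<noteq> k" for i k
    by (rule hadamard_maximizer_orthogonal[OF _ _ _ that]) (use A Amax det in \<open>auto simp: S_def\<close>)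
  have "norm (A $ i) = 1" for i
  proof -
    have "1 \<le> (det A)\<^sup>2" using det by (auto simp: power2_ge_1_iff)
    also have "\<dots> = (norm (A $ i))\<^sup>2 * (\<Prod>k\<in>UNIV - {i}. (norm (A $ k))\<^sup>2)"
      using det_row_orthogonal[OF orth] by (simp add: prod.remove[of UNIV i])
    also have "\<dots> \<le> (norm (A $ i))\<^sup>2 * 1"
      by (intro mult_left_mono prod_le_1) (use A in \<open>auto simp: power_le_one\<close>)
    finally have "1 \<le> norm (A $ i)" using norm_ge_zero[of "A $ i"] by (simp add: power2_ge_1_iff)
    with A[of i] show ?thesis by simp
  qed
  with orth show ?thesis
    unfolding orthogonal_matrix_orthonormal_rows by (simp add: row_eq_nth orthogonal_def)
qed

section \<open>Rows of a linear map into the cube\<close>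

lemma linear_component_eq_inner:
  fixes f :: "real ^ 'n \<Rightarrow> real ^ 'm"
  assumes "linear f"
  shows "f x $ i = matrix f $ i \<bullet> x"
proof -
  have "f x = matrix f *v x"
    using matrix_works[of f x] assms by (simp only: linear_matrix_vector_mul_eq)
  then show ?thesis by (simp only: matrix_vector_mul_component)
qed

text \<open>The unit vector along row \<open>i\<close> and its negative are sent to points whose
  \<open>i\<close>-th coordinates are \<open>c $ i\<close> plus and minus the norm of the row. Both
  lie in [-1, 1], and comparing them cancels \<open>c $ i\<close>.\<close>

lemma norm_row_le_1_if_subset_cube:
  fixes f :: "real ^ 'n \<Rightarrow> real ^ 'n"
  assumes f: "linear f" and sub: "\<And>x. norm x \<le> 1 \<Longrightarrow> f x + c \<in> cube"
  shows "norm (matrix f $ i) \<le> 1"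
proof (cases "matrix f $ i = 0")
  case False
  let ?r = "matrix f $ i"
  let ?x = "(1 / norm ?r) *\<^sub>R ?r"
  have fx: "f ?x $ i = norm ?r"
    unfolding linear_component_eq_inner[OF f] using False
    by (simp add: power2_eq_square flip: power2_norm_eq_inner)
  have "f ?x + c \<in> cube" "f (- ?x) + c \<in> cube"
    using False by (auto intro!: sub)
  then have "f ?x $ i + c $ i \<le> 1" "-1 \<le> - f ?x $ i + c $ i"
    using f by (auto simp: cube_def linear_neg)
  then show ?thesis unfolding fx by simp
qed simp

section \<open>Volume of linear images\<close>

text \<open>The map is a row operation on the identity, so its determinant is 1, and it suffices to
  compare volumes of boxes. Translating a box only translates its image.\<close>

lemma measurable_measure_shear:
  fixes S :: "(real ^ 'n) set"
  assumes mn: "m \<noteq> n" and S: "S \<in> lmeasurable"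
  defines "h \<equiv> \<lambda>x :: real ^ 'n. \<chi> i. if i = m then x $ m + x $ n else x $ i"
  shows "h ` S \<in> lmeasurable \<and> measure lebesgue (h ` S) = \<bar>det (matrix h)\<bar> * measure lebesgue S"
proof -
  have h: "linear h"
    unfolding h_def by (rule linearI) (auto simp: vec_eq_iff algebra_simps)
  have "matrix h = (\<chi> k. if k = m then row m (mat 1) + 1 *s row n (mat 1) else row k (mat 1))"
    using mn by (simp add: h_def matrix_def row_def mat_def axis_def vec_eq_iff)
  then have det: "det (matrix h) = 1"
    using det_row_operation[OF mn, of "mat 1 :: real ^ 'n ^ 'n" 1] by simp
  have "measure lebesgue (h ` cbox a b) = 1 * measure lebesgue (cbox a b)" for a b
  proof (cases "cbox a b = {}")
    case False
    \<comment> \<open>The library computes the volume of a sheared box only where the \<open>n\<close>-th coordinate is nonnegative.\<close>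
    define v :: "real ^ 'n" where "v = axis n \<bar>a $ n\<bar>"
    have "cbox (v + a) (v + b) \<noteq> {}" using False by (simp add: cbox_translation)
    then have "measure lebesgue (h ` cbox (v + a) (v + b)) = measure lebesgue (cbox (v + a) (v + b))"
      unfolding h_def
      by (rule measure_shear_interval[OF mn]) (auto simp: v_def)
    moreover have "h ` cbox (v + a) (v + b) = (+) (h v) ` h ` cbox a b"
      unfolding cbox_translation image_image using h by (simp add: linear_add)
    ultimately show ?thesis
      by (simp add: cbox_translation measure_translation)
  qed simp
  from measure_linear_sufficient[OF h S this] det show ?thesis by simp
qed

text \<open>A coordinate swap sends a box to the box with swapped corners, which has the same
  product of side lengths.\<close>

lemma measurable_measure_swap:
  fixes S :: "(real ^ 'n) set" and m n :: 'n
  assumes S: "S \<in> lmeasurable"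
  defines "h \<equiv> \<lambda>x :: real ^ 'n. \<chi> i. x $ Transposition.transpose m n i"
  shows "h ` S \<in> lmeasurable \<and> measure lebesgue (h ` S) = \<bar>det (matrix h)\<bar> * measure lebesgue S"
proof -
  let ?\<tau> = "Transposition.transpose m n"
  have perm: "?\<tau> permutes UNIV" by (rule permutes_swap_id) auto
  have h: "linear h"
    unfolding h_def by (rule linearI) (auto simp: vec_eq_iff)
  have "matrix h = (\<chi> i. mat 1 $ ?\<tau> i)"
    by (simp add: h_def matrix_def mat_def axis_def vec_eq_iff)
  then have det: "\<bar>det (matrix h)\<bar> = 1"
    using det_permute_rows[OF perm, of "mat 1 :: real ^ 'n ^ 'n"]
    by (simp add: sign_swap_id abs_mult)
  have hh: "h (h x) = x" for x by (simp add: h_def vec_eq_iff)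
  have "measure lebesgue (h ` cbox a b) = 1 * measure lebesgue (cbox a b)" for a b
  proof (cases "cbox a b = {}")
    case False
    have mem: "h x \<in> cbox (h a) (h b) \<longleftrightarrow> x \<in> cbox a b" for x a b
      proof -
      have "surj ?\<tau>" using perm by (rule permutes_surj)
      then have "(\<forall>i. P (?\<tau> i)) \<longleftrightarrow> (\<forall>i. P i)" for P by (metis surjD)
      from this[of "\<lambda>i. a $ i \<le> x $ i \<and> x $ i \<le> b $ i"] show ?thesis
        by (simp add: mem_box_cart h_def)
    qed
    have "h ` cbox a b = cbox (h a) (h b)"
    proof (intro equalityI subsetI)
      fix y assume "y \<in> cbox (h a) (h b)"
      then have "h y \<in> cbox a b" using mem[of "h y" a b] by (simp add: hh)
      then show "y \<in> h ` cbox a b" using hh by (metis imageI)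
    qed (auto simp: mem)
    moreover from this have "cbox (h a) (h b) \<noteq> {}" using False by (metis image_is_empty)
    moreover have "(\<Prod>i\<in>UNIV. (b - a) $ ?\<tau> i) = (\<Prod>i\<in>UNIV. (b - a) $ i)"
      by (rule prod.permute[OF perm, unfolded comp_def, symmetric])
    ultimately show ?thesis using False by (simp add: content_cbox_cart h_def)
  qed simp
  from measure_linear_sufficient[OF h S this] det show ?thesis by simp
qed

text \<open>The library's \<open>measure_linear_image\<close> is restricted to well-ordered index types.\<close>

lemma measurable_measure_linear_image:
  fixes f :: "real ^ 'n \<Rightarrow> real ^ 'n"
  assumes "linear f" "S \<in> lmeasurable"
  shows "f ` S \<in> lmeasurable \<and> measure lebesgue (f ` S) = \<bar>det (matrix f)\<bar> * measure lebesgue S"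
proof -
  define P :: "(real ^ 'n \<Rightarrow> real ^ 'n) \<Rightarrow> bool" where
    "P = (\<lambda>f. \<forall>S\<in>lmeasurable. f ` S \<in> lmeasurable \<and> measure lebesgue (f ` S) = \<bar>det (matrix f)\<bar> * measure lebesgue S)"
  have "P f"
  proof (rule induct_linear_elementary[OF assms(1), of P])
    fix f g :: "real ^ 'n \<Rightarrow> real ^ 'n"
    assume lin: "linear f" "linear g" and f: "P f" and g: "P g"
    have "matrix (f \<circ> g) = matrix f ** matrix g" by (rule matrix_compose[OF lin(2,1)])
    then have "\<bar>det (matrix (f \<circ> g))\<bar> = \<bar>det (matrix f)\<bar> * \<bar>det (matrix g)\<bar>"
      by (simp only: det_mul abs_mult)
    moreover have "(f \<circ> g) ` S = f ` g ` S" for S by (rule image_comp[symmetric])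
    ultimately show "P (f \<circ> g)"
      using f g unfolding P_def by (simp add: mult.assoc del: o_apply)
  next
    fix f :: "real ^ 'n \<Rightarrow> real ^ 'n" and i
    assume f: "linear f" and zero: "\<And>x. f x $ i = 0"
    \<comment> \<open>A map with a vanishing coordinate is singular: its image is negligible and its
      determinant is 0, so both sides vanish.\<close>
    have "\<not> surj f"
    proof
      assume "surj f"
      then obtain x where "axis i 1 = f x" using surjD[of f "axis i 1"] by blast
      then have "axis i (1::real) $ i = f x $ i" by simp
      then show False using zero[of x] by simp
    qed
    then have "\<not> inj f" using linear_injective_imp_surjective[OF f] by blast
    then have "negligible (f ` S)" "det (matrix f) = 0" for S
      using f negligible_linear_singular_image det_nz_iff_inj by blast+
    then show "P f"
      unfolding P_def by (simp add: negligible_imp_measurable negligible_imp_measure0)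
  next
    fix c :: "'n \<Rightarrow> real"
    have "det (matrix (\<lambda>x :: real ^ 'n. \<chi> i. c i * x $ i)) = prod c UNIV"
      by (subst det_diagonal) (auto simp: matrix_def axis_def)
    then show "P (\<lambda>x. \<chi> i. c i * x $ i)"
      unfolding P_def by (simp add: measurable_stretch measure_stretch)
  next
    fix m n :: 'n
    show "P (\<lambda>x. \<chi> i. x $ Transposition.transpose m n i)"
      unfolding P_def by (intro ballI measurable_measure_swap)
    show "P (\<lambda>x. \<chi> i. if i = m then x $ m + x $ n else x $ i)" if "m \<noteq> n"
      unfolding P_def using that by (intro ballI measurable_measure_shear)
  qed
  with assms(2) show ?thesis by (auto simp: P_def)
qed

section \<open>The maximum volume ellipsoid\<close>

text \<open>The volume ratio is the absolute determinant of \<open>f\<close>. If it were at least 1,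
  the equality case of Hadamard's inequality would make \<open>f\<close> orthogonal and
  \<open>E\<close> a unit ball centered at \<open>c\<close>, and the cube then forces
  \<open>c = 0\<close>.\<close>

lemma measure_ellipsoid_in_cube:
  fixes E :: "(real ^ 'n) set"
  assumes "ellipsoid E" and sub: "E \<subseteq> cube" and ne: "E \<noteq> cball 0 1"
  shows "measure lebesgue E < measure lebesgue (cball 0 1 :: (real ^ 'n) set)"
proof -
  obtain f :: "real ^ 'n \<Rightarrow> real ^ 'n" and c where f: "linear f"
    and E: "E = (\<lambda>x. x + c) ` f ` cball 0 1"
    using assms(1) unfolding ellipsoid_def centered_ellipsoid_def by blast
  have rows: "norm (matrix f $ i) \<le> 1" for i
    by (rule norm_row_le_1_if_subset_cube[OF f, of c]) (use sub E in auto)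
  have "E = (+) c ` f ` cball 0 1" unfolding E by (simp add: add.commute)
  then have meas: "measure lebesgue E = \<bar>det (matrix f)\<bar> * measure lebesgue (cball 0 1 :: (real ^ 'n) set)"
    using measurable_measure_linear_image[OF f, of "cball 0 1"] by (simp add: measure_translation)
  have "\<bar>det (matrix f)\<bar> < 1"
  proof (rule ccontr)
    assume "\<not> \<bar>det (matrix f)\<bar> < 1"
    then have "orthogonal_matrix (matrix f)"
      by (intro hadamard_rows_orthonormal rows) simp
    then have "orthogonal_transformation f"
      by (simp add: orthogonal_transformation_matrix f)
    then have "f ` cball 0 1 = cball 0 1"
      using image_orthogonal_transformation_cball[of f 0 1] by (simp add: linear_0 f)
    then have E': "E = (\<lambda>x. x + c) ` cball 0 1" by (simp add: E)
    have "c $ i = 0" for i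
    proof -
      have "axis i 1 + c \<in> cube" "- axis i 1 + c \<in> cube"
        using sub unfolding E' by auto
      then have "1 + c $ i \<le> 1" "-1 \<le> -1 + c $ i"
        unfolding cube_def by (metis (no_types, lifting) mem_Collect_eq vector_add_component axis_nth
          vector_uminus_component)+
      then show ?thesis by simp
    qed
    then have "c = 0" by (simp add: vec_eq_iff)
    with E' ne show False by simp
  qed
  moreover have "measure lebesgue (cball 0 1 :: (real ^ 'n) set) > 0"
    by (simp add: content_cball_pos)
  ultimately show ?thesis by (simp add: meas)
qed

lemma cball_subset_cube: "cball 0 1 \<subseteq> (cube :: (real ^ 'n) set)"
proof
  fix x :: "real ^ 'n" assume "x \<in> cball 0 1"
  then have "\<bar>x $ i\<bar> \<le> 1" for i using component_le_norm_cart[of x i] by simp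
  then show "x \<in> cube" by (force simp: cube_def abs_le_iff)
qed

lemma centered_ellipsoid_cball: "centered_ellipsoid (cball 0 1)"
  unfolding centered_ellipsoid_def by (rule exI[of _ id]) (auto simp: linear_id)

lemma is_max_volume_ellipsoid_cball:
  fixes K :: "(real ^ 'n) set"
  assumes "cball 0 1 \<subseteq> K" "K \<subseteq> cube"
  shows "is_max_volume_ellipsoid (cball 0 1) K"
proof -
  have "ellipsoid (cball 0 1 :: (real ^ 'n) set)"
    unfolding ellipsoid_def by (intro exI[of _ "cball 0 1"] exI[of _ 0]) (auto simp: centered_ellipsoid_cball)
  then show ?thesis
    using assms measure_ellipsoid_in_cube unfolding is_max_volume_ellipsoid_def by blast
qed

section \<open>Lower bound for the Banach-Mazur distance\<close>

text \<open>Rows of \<open>f\<close> of norm at most 1 force its inverse \<open>g\<close> to send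
  axis vectors to vectors of norm at least 1. For suitable signs, a point \<open>x\<close> with
  coordinates \<plusminus>\<open>c\<close> then has \<open>norm (g x)\<close> at least
  \<open>c\<close> times the root of the dimension, while the outer inclusion bounds
  \<open>norm (g x)\<close> by \<open>l\<close>.\<close>

lemma BM_dist_ball_lower_bound:
  fixes K :: "(real ^ 'n) set"
  assumes K: "K \<subseteq> cube" and signs: "\<And>x. (\<And>i. \<bar>x $ i\<bar> = c) \<Longrightarrow> x \<in> K" and "c \<ge> 0" and "l > 0"
    and E: "centered_ellipsoid E" "E \<subseteq> (\<lambda>x. x - a) ` K" "(\<lambda>x. x - a) ` K \<subseteq> (\<lambda>x. l *\<^sub>R x) ` E"
  shows "c * sqrt (real CARD('n)) \<le> l"
proof -
  obtain f :: "real ^ 'n \<Rightarrow> real ^ 'n" where f: "linear f" "bij f" and Ef: "E = f ` cball 0 1"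
    using E(1) unfolding centered_ellipsoid_def by blast
  define g where "g = inv f"
  have g: "linear g" unfolding g_def using f by (simp add: bij_is_inj inj_linear_imp_inv_linear)
  have gf: "g (f x) = x" and fg: "f (g x) = x" for x
    using f(2) by (auto simp: g_def bij_is_inj bij_is_surj surj_f_inv_f)
  have rows: "norm (matrix f $ i) \<le> 1" for i
  proof (rule norm_row_le_1_if_subset_cube[OF f(1), of a])
    fix x :: "real ^ 'n" assume "norm x \<le> 1"
    then have "f x \<in> (\<lambda>x. x - a) ` K" using E(2) Ef by auto
    then show "f x + a \<in> cube" using K by auto
  qed
  have bound: "norm (g (x - a)) \<le> l" if "x \<in> K" for x
  proof -
    have "x - a \<in> (\<lambda>x. l *\<^sub>R x) ` f ` cball 0 1" using that E(3) Ef by blast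
    then obtain y where "norm y \<le> 1" "x - a = l *\<^sub>R f y" by auto
    then show ?thesis using g \<open>l > 0\<close> by (simp add: linear_scale gf mult_left_le)
  qed
  define e :: "'n \<Rightarrow> real ^ 'n" where "e = (\<lambda>i. axis i 1)"
  obtain s :: "'n \<Rightarrow> real" where s: "\<And>i. \<bar>s i\<bar> = 1"
    and le: "(\<Sum>i\<in>UNIV. (norm (g (e i)))\<^sup>2) \<le> (norm (\<Sum>i\<in>UNIV. s i *\<^sub>R g (e i)))\<^sup>2"
    using signs_exist[of UNIV "\<lambda>i. g (e i)"] by auto
  define x :: "real ^ 'n" where "x = (\<Sum>i\<in>UNIV. (c * s i) *\<^sub>R e i)"
  have xi: "x $ i = c * s i" for i
    by (simp add: x_def e_def axis_def if_distrib cong: if_cong)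
  have "x \<in> K" "- x \<in> K" using s \<open>c \<ge> 0\<close> by (auto intro!: signs simp: xi abs_mult)
  \<comment> \<open>Using both \<open>x\<close> and \<open>- x\<close> eliminates the unknown center
    \<open>a\<close>.\<close>
  then have "norm (g (x - a) - g (- x - a)) \<le> 2 * l"
    using bound[of x] bound[of "- x"] norm_triangle_ineq4[of "g (x - a)" "g (- x - a)"] by simp
  also have "g (x - a) - g (- x - a) = 2 *\<^sub>R g x"
    using g by (simp add: linear_diff linear_neg scaleR_2)
  finally have gx: "norm (g x) \<le> l" by simp
  have "g x = c *\<^sub>R (\<Sum>i\<in>UNIV. s i *\<^sub>R g (e i))"
    using g by (simp add: x_def linear_sum linear_scale scaleR_sum_right)
  then have "c\<^sup>2 * (\<Sum>i\<in>UNIV. (norm (g (e i)))\<^sup>2) \<le> (norm (g x))\<^sup>2"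
    using le by (simp add: power_mult_distrib mult_left_mono)
  also have "\<dots> \<le> l\<^sup>2" using gx by (simp add: power_mono)
  finally have cg: "c\<^sup>2 * (\<Sum>i\<in>UNIV. (norm (g (e i)))\<^sup>2) \<le> l\<^sup>2" .
  \<comment> \<open>Row \<open>i\<close> of \<open>f\<close> has inner product 1 with
    \<open>g (e i)\<close>, so Cauchy-Schwarz applies.\<close>
  have "1 \<le> (norm (g (e i)))\<^sup>2" for i
  proof -
    have "1 = f (g (e i)) $ i" by (simp add: fg e_def)
    also have "\<dots> \<le> norm (matrix f $ i) * norm (g (e i))"
      unfolding linear_component_eq_inner[OF f(1)] by (rule norm_cauchy_schwarz)
    also have "\<dots> \<le> norm (g (e i))" using rows[of i] by (simp add: mult_left_le_one_le)
    finally show ?thesis by (rule one_le_power)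
  qed
  then have "(\<Sum>i\<in>(UNIV::'n set). 1) \<le> (\<Sum>i\<in>UNIV. (norm (g (e i)))\<^sup>2)"
    by (intro sum_mono) auto
  then have "c\<^sup>2 * real CARD('n) \<le> c\<^sup>2 * (\<Sum>i\<in>UNIV. (norm (g (e i)))\<^sup>2)"
    by (intro mult_left_mono) auto
  then have "c\<^sup>2 * real CARD('n) \<le> l\<^sup>2" using cg by linarith
  then have "(c * sqrt (real CARD('n)))\<^sup>2 \<le> l\<^sup>2" by (simp add: power_mult_distrib)
  then show ?thesis by (rule power2_le_imp_le) (use \<open>l > 0\<close> in simp)
qed

section \<open>Contact points from simplex vertices\<close>

text \<open>\<open>u k\<close> is the axis vector at \<open>j\<close> plus \<open>t\<close> times
  the \<open>k\<close>-th Sylvester column without its constant row, padded with zeros. In the norm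
  formula the sum of squares comes from orthogonality of the full columns; the deleted row accounts
  for the subtracted square.\<close>

lemma sylvester_vectors_exist:
  fixes j :: "'n::finite"
  assumes N: "2^p \<le> CARD('n)" and t: "\<bar>t\<bar> \<le> 1"
  shows "\<exists>u :: nat \<Rightarrow> real ^ 'n. (\<forall>k<2^p. u k \<in> cube \<and> u k $ j = 1) \<and>
    (\<forall>B \<beta> c. B \<subseteq> {..<2^p} \<longrightarrow> (norm ((\<Sum>k\<in>B. \<beta> k *\<^sub>R u k) - c *\<^sub>R axis j 1))\<^sup>2
       = ((\<Sum>k\<in>B. \<beta> k) - c)\<^sup>2 + t\<^sup>2 * (2^p * (\<Sum>k\<in>B. (\<beta> k)\<^sup>2) - (\<Sum>k\<in>B. \<beta> k)\<^sup>2))"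
proof -
  define N :: nat where "N = 2^p"
  define d where "d = CARD('n)"
  have N0: "0 < N" and Nd: "N \<le> d" using N by (auto simp: N_def d_def)
  obtain H :: "nat \<Rightarrow> nat \<Rightarrow> real" where
    abs: "\<And>a k. a < N \<Longrightarrow> k < N \<Longrightarrow> \<bar>H a k\<bar> = 1" and row0: "\<And>k. k < N \<Longrightarrow> H 0 k = 1" and
    orth: "\<And>k l. k < N \<Longrightarrow> l < N \<Longrightarrow> (\<Sum>a<N. H a k * H a l) = (if k = l then real N else 0)"
    using sylvester_matrix_exists[of p] unfolding N_def by force
  obtain g :: "'n \<Rightarrow> nat" where g: "bij_betw g UNIV {..<d}" and gj: "g j = 0"
  proof -
    obtain h :: "'n \<Rightarrow> nat" where h: "bij_betw h UNIV {0..<d}"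
      using ex_bij_betw_finite_nat[of "UNIV :: 'n set"] by (auto simp: d_def)
    \<comment> \<open>\<open>\<tau>\<close> swaps 0 and \<open>h j\<close>, so that coordinate
      \<open>j\<close> gets index 0, the place of the constant row.\<close>
    define \<tau> where "\<tau> a = (if a = 0 then h j else if a = h j then 0 else a)" for a
    have "h j \<in> {0..<d}" using h by (auto simp: bij_betw_def)
    then have "bij_betw \<tau> {0..<d} {0..<d}"
      using N0 Nd by (intro bij_betw_byWitness[where f' = \<tau>]) (auto simp: \<tau>_def)
    with h have "bij_betw (\<tau> \<circ> h) UNIV {0..<d}" by (rule bij_betw_trans)
    moreover have "(\<tau> \<circ> h) j = 0" by (simp add: \<tau>_def)
    ultimately show ?thesis using that by (simp add: lessThan_atLeast0)
  qed
  define U where "U k a = (if a = 0 then 1 else if a < N then t * H a k else 0)" for k a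
  define u :: "nat \<Rightarrow> real ^ 'n" where "u k = (\<chi> i. U k (g i))" for k
  have "\<bar>U k a\<bar> \<le> 1" if "k < N" for k a
    using that abs t by (simp add: U_def abs_mult)
  then have cube: "u k \<in> cube" if "k < N" for k
    using that by (force simp: cube_def u_def abs_le_iff)
  have uj: "u k $ j = 1" for k by (simp add: u_def gj U_def)
  have g0: "g i = 0 \<longleftrightarrow> i = j" for i
    using g gj by (metis bij_betw_imp_inj_on injD)
  have "(norm ((\<Sum>k\<in>B. \<beta> k *\<^sub>R u k) - c *\<^sub>R axis j 1))\<^sup>2
       = ((\<Sum>k\<in>B. \<beta> k) - c)\<^sup>2 + t\<^sup>2 * (real N * (\<Sum>k\<in>B. (\<beta> k)\<^sup>2) - (\<Sum>k\<in>B. \<beta> k)\<^sup>2)"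
    if B: "B \<subseteq> {..<N}" for B \<beta> c
  proof -
    have finB: "finite B" using B finite_subset by blast
    define s where "s = (\<Sum>k\<in>B. \<beta> k)"
    define F where "F a = ((\<Sum>k\<in>B. \<beta> k * U k a) - (if a = 0 then c else 0))\<^sup>2" for a
    define P where "P a = (\<Sum>k\<in>B. \<beta> k * H a k)" for a
    have "(norm ((\<Sum>k\<in>B. \<beta> k *\<^sub>R u k) - c *\<^sub>R axis j 1))\<^sup>2 = (\<Sum>i\<in>UNIV. F (g i))"
      unfolding power2_norm_eq_inner inner_vec_def
      by (intro sum.cong) (auto simp: F_def u_def g0 axis_def power2_eq_square)
    also have "\<dots> = (\<Sum>a<d. F a)" using sum.reindex_bij_betw[OF g] by simp
    also have "\<dots> = (\<Sum>a<N. F a)"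
      by (rule sum.mono_neutral_right) (use Nd N0 in \<open>auto simp: F_def U_def\<close>)
    also have "\<dots> = F 0 + (\<Sum>a\<in>{..<N}-{0}. F a)"
      using N0 by (simp add: sum.remove)
    also have "F 0 = (s - c)\<^sup>2" by (simp add: F_def U_def s_def)
    also have "(\<Sum>a\<in>{..<N}-{0}. F a) = (\<Sum>a\<in>{..<N}-{0}. t\<^sup>2 * (P a)\<^sup>2)"
      by (intro sum.cong refl)
        (auto simp: F_def U_def P_def mult.left_commute power_mult_distrib simp flip: sum_distrib_left)
    \<comment> \<open>Row 0 is added and subtracted, because the orthogonality relations sum over
      all rows.\<close>
    also have "\<dots> = t\<^sup>2 * ((\<Sum>a<N. (P a)\<^sup>2) - (P 0)\<^sup>2)"
      using N0 by (simp add: sum_diff1 flip: sum_distrib_left)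
    also have "P 0 = s" unfolding P_def s_def using B row0 by (intro sum.cong) auto
    also have "(\<Sum>a<N. (P a)\<^sup>2) = (\<Sum>a<N. \<Sum>k\<in>B. \<Sum>l\<in>B. \<beta> k * \<beta> l * (H a k * H a l))"
      by (simp add: P_def power2_eq_square sum_product mult_ac)
    also have "\<dots> = (\<Sum>k\<in>B. \<Sum>l\<in>B. \<Sum>a<N. \<beta> k * \<beta> l * (H a k * H a l))"
      by (subst sum.swap) (intro sum.cong refl sum.swap)
    also have "\<dots> = (\<Sum>k\<in>B. \<Sum>l\<in>B. \<beta> k * \<beta> l * (if k = l then real N else 0))"
      unfolding sum_distrib_left[symmetric] using B orth by (intro sum.cong refl) (simp add: subset_iff)
    also have "\<dots> = real N * (\<Sum>k\<in>B. (\<beta> k)\<^sup>2)"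
      using finB by (simp add: if_distrib sum_distrib_left power2_eq_square mult_ac cong: if_cong)
    finally show ?thesis by (simp add: s_def)
  qed
  then show ?thesis
    using cube uj by (intro exI[of _ u]) (auto simp: N_def)
qed

section \<open>The cube cut by a ball\<close>

text \<open>The unit ball with \<open>a = 0\<close> attains \<open>r\<close>. For the lower bound,
  \<open>c\<close> is chosen so that points with coordinates \<plusminus>\<open>c\<close> lie on the
  sphere of radius \<open>r\<close>; the upper bound on \<open>r\<close> gives
  \<open>c \<le> 1\<close> and keeps them in the cube.\<close>

lemma BM_dist_ball_cube_Int_cball:
  assumes "1 \<le> r" and r: "r \<le> sqrt (real CARD('n))"
  shows "BM_dist_ball (cube \<inter> cball 0 r :: (real ^ 'n) set) = r"
proof -
  let ?K = "cube \<inter> cball 0 r :: (real ^ 'n) set"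
  define c where "c = r / sqrt (real CARD('n))"
  have c: "0 \<le> c" "c \<le> 1" "c * sqrt (real CARD('n)) = r"
    using assms by (auto simp: c_def divide_le_eq)
  have corners: "x \<in> ?K" if x: "\<And>i. \<bar>x $ i\<bar> = c" for x
  proof -
    have "(norm x)\<^sup>2 = (\<Sum>i\<in>UNIV. \<bar>x $ i\<bar>\<^sup>2)"
      by (simp add: power2_norm_eq_inner inner_vec_def flip: power2_eq_square)
    also have "\<dots> = r\<^sup>2" using c(3) by (simp add: x power_mult_distrib flip: c(3))
    finally have "norm x = r" using assms by simp
    moreover have "x \<in> cube" using x c(2) by (simp add: cube_def flip: abs_le_iff) (metis abs_le_D1 abs_le_D2 minus_le_iff)
    ultimately show ?thesis by simp
  qed
  define S where "S = {l. 0 < l \<and> (\<exists>E a. centered_ellipsoid E \<and> E \<subseteq> (\<lambda>x. x - a) ` ?K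
     \<and> (\<lambda>x. x - a) ` ?K \<subseteq> (\<lambda>x. l *\<^sub>R x) ` E)}"
  have "Inf S = r"
  proof (rule cInf_eq_minimum)
    have "cball 0 1 \<subseteq> (\<lambda>x. x - 0) ` ?K"
      using cball_subset_cube assms(1) by auto
    moreover have "(\<lambda>x. x - 0) ` ?K \<subseteq> (\<lambda>x. r *\<^sub>R x) ` cball 0 1"
      using cball_scale[of r 0 1] assms(1) by auto
    ultimately show "r \<in> S" using assms(1) centered_ellipsoid_cball unfolding S_def by force
  next
    fix l assume "l \<in> S"
    then show "r \<le> l"
      unfolding S_def using BM_dist_ball_lower_bound[OF _ corners c(1)] c(3) by auto
  qed
  then show ?thesis by (simp add: BM_dist_ball_def S_def)
qed

lemma convex_body_cube_Int_cball:
  assumes "1 \<le> r"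
  shows "convex_body (cube \<inter> cball 0 r :: (real ^ 'n) set)"
proof -
  have "(cube :: (real ^ 'n) set) = cbox (- 1) 1" by (auto simp: cube_def mem_box_cart)
  then have "convex (cube :: (real ^ 'n) set)" "compact (cube :: (real ^ 'n) set)"
    using convex_box(1) compact_cbox by metis+
  moreover have "ball 0 1 \<subseteq> interior (cube \<inter> cball 0 r :: (real ^ 'n) set)"
    using cball_subset_cube assms by (intro interior_maximal) auto
  then have "0 \<in> interior (cube \<inter> cball 0 r :: (real ^ 'n) set)" by (rule subsetD) simp
  then have "interior (cube \<inter> cball 0 r :: (real ^ 'n) set) \<noteq> {}" by blast
  ultimately show ?thesis
    unfolding convex_body_def by (blast intro: convex_Int compact_Int convex_cball compact_cball)
qed

section \<open>Boundary points of the body and its polar\<close>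

lemma frontier_if_scaled_notin:
  fixes x :: "'a::real_normed_vector"
  assumes "x \<in> S" and out: "\<And>t. t > 1 \<Longrightarrow> t *\<^sub>R x \<notin> S"
  shows "x \<in> frontier S"
proof -
  have "x \<notin> interior S"
  proof
    assume "x \<in> interior S"
    then obtain e where e: "e > 0" "ball x e \<subseteq> S" by (auto simp: mem_interior)
    \<comment> \<open>The stretch moves \<open>x\<close> by less than \<open>e\<close>; the added 1
      in the denominator covers \<open>x = 0\<close>.\<close>
    define t where "t = 1 + e / (2 * (norm x + 1))"
    have "norm x * e < 2 * (norm x + 1) * e" 
      using e(1) by (intro mult_strict_right_mono) (auto intro: add_nonneg_pos)
    then have "(t - 1) * norm x < e"
      by (simp add: t_def divide_less_eq add_nonneg_pos mult_ac)
    moreover have "t > 1" using e(1) by (simp add: t_def add_nonneg_pos)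
    moreover have "dist x (t *\<^sub>R x) = (t - 1) * norm x"
      using \<open>t > 1\<close> by (simp add: dist_norm norm_minus_commute[of x] flip: scaleR_left_diff_distrib[of t 1 x, simplified])
    ultimately have "t *\<^sub>R x \<in> S" using e(2) by auto
    with out \<open>t > 1\<close> show False by blast
  qed
  then show ?thesis using \<open>x \<in> S\<close> closure_subset by (auto simp: frontier_def)
qed

text \<open>The axis vector lies in \<open>K\<close> itself, so any larger multiple of it violates
  the polar inequality at that point.\<close>

lemma axis_in_frontier_polar:
  fixes K :: "(real ^ 'n) set"
  assumes "K \<subseteq> cube" "axis j 1 \<in> K"
  shows "axis j 1 \<in> frontier (polar K)"
proof (rule frontier_if_scaled_notin)
  show "axis j 1 \<in> polar K"
    using assms(1) by (auto simp: polar_def inner_axis' cube_def)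
  fix t :: real assume "t > 1"
  moreover have "(t *\<^sub>R axis j 1) \<bullet> (axis j 1 :: real ^ 'n) = t" by (simp add: inner_axis')
  ultimately show "t *\<^sub>R axis j 1 \<notin> polar K"
    using assms(2) unfolding polar_def by fastforce
qed

lemma in_frontier_if_component_1:
  fixes K :: "(real ^ 'n) set"
  assumes "K \<subseteq> cube" "x \<in> K" "x $ j = 1"
  shows "x \<in> frontier K"
proof (rule frontier_if_scaled_notin[OF assms(2)])
  fix t :: real assume "t > 1"
  then have "(t *\<^sub>R x) $ j > 1" using assms(3) by simp
  then have "t *\<^sub>R x \<notin> cube" by (auto simp: cube_def not_le intro!: exI[of _ j])
  then show "t *\<^sub>R x \<notin> K" using assms(1) by blast
qed

section \<open>Counting bounds\<close>

text \<open>The second summand of the last hypothesis is the squared norm of the combination, with weights \<open>\<beta>\<close>,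
  of vertices of a regular simplex with \<open>N\<close> vertices and circumradius \<open>\<delta>\<close>.\<close>

lemma simplex_deviation_card_bound:
  fixes \<beta> :: "nat \<Rightarrow> real" and \<epsilon> t N d \<delta> :: real
  assumes B: "finite B" and \<epsilon>: "0 < \<epsilon>" "\<epsilon> < 1/2" and N: "2 \<le> N" "d < 2 * N" and t: "t\<^sup>2 * (N - 1) = \<delta>\<^sup>2"
    and dev: "(sum \<beta> B - 1)\<^sup>2 + t\<^sup>2 * (N * (\<Sum>k\<in>B. (\<beta> k)\<^sup>2) - (sum \<beta> B)\<^sup>2) \<le> \<epsilon>\<^sup>2"
  shows "real (card B) \<ge> min (d / 4) ((\<delta> / (4 * \<epsilon>))\<^sup>2)"
proof (rule ccontr)
  assume "\<not> ?thesis"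
  then have small: "real (card B) < d / 4" and contra: "real (card B) < (\<delta> / (4 * \<epsilon>))\<^sup>2" by auto
  define s where "s = sum \<beta> B"
  define q where "q = (\<Sum>k\<in>B. (\<beta> k)\<^sup>2)"
  define b where "b = real (card B)"
  have q: "q \<ge> 0" by (simp add: q_def sum_nonneg)
  have cs: "s\<^sup>2 \<le> b * q"
    using sum_squared_le_sum_of_squares[of \<beta> B] unfolding s_def q_def b_def by (simp add: mult.commute)
  \<comment> \<open>As \<open>d / 4 < N / 2\<close>, Cauchy-Schwarz shows that the subtracted
    \<open>s\<^sup>2\<close> costs at most half of \<open>N * q\<close>.\<close>
  have "b \<le> N / 2" using small N(2) by (simp add: b_def)
  then have "b * q \<le> N / 2 * q" using q by (rule mult_right_mono)
  with cs have half: "N / 2 * q \<le> N * q - s\<^sup>2" by simp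
  then have nonneg: "0 \<le> t\<^sup>2 * (N * q - s\<^sup>2)"
    using q N(1) by (smt (verit) mult_nonneg_nonneg divide_nonneg_pos zero_le_power2)
  have "(s - 1)\<^sup>2 \<le> \<epsilon>\<^sup>2" using dev nonneg unfolding s_def q_def by linarith
  then have "\<bar>s - 1\<bar> \<le> \<epsilon>" using \<epsilon>(1) by (simp flip: abs_le_square_iff)
  then have s: "s > 1/2" using \<epsilon>(2) by linarith
  then have "B \<noteq> {}" by (auto simp: s_def)
  then have b: "b > 0" using B by (simp add: b_def card_gt_0_iff)
  have "(1/2)\<^sup>2 \<le> s\<^sup>2" using s by (intro power_mono) auto
  then have s4: "1/4 \<le> s\<^sup>2" by (simp add: power2_eq_square)
  \<comment> \<open>Few weights with sum above 1/2 cannot all be small: \<open>q\<close> is at least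
    \<open>s\<^sup>2 / b\<close>, hence at least \<open>1 / (4 * b)\<close>.\<close>
  have "N / 2 * (1 / (4 * b)) \<le> N / 2 * q"
    using cs s4 b N(1) by (intro mult_left_mono) (auto simp: field_simps)
  also have "\<dots> \<le> N * q - s\<^sup>2" by (rule half)
  finally have lower: "N * q - s\<^sup>2 \<ge> N / (8 * b)" by simp
  have "\<delta>\<^sup>2 / (8 * b) \<le> t\<^sup>2 * (N / (8 * b))"
    using b by (simp add: t[symmetric] divide_right_mono mult_left_mono)
  also have "\<dots> \<le> t\<^sup>2 * (N * q - s\<^sup>2)" using lower by (rule mult_left_mono) simp
  also have "\<dots> \<le> \<epsilon>\<^sup>2" using dev unfolding s_def q_def by (smt (verit) zero_le_power2)
  finally have "\<delta>\<^sup>2 \<le> 8 * (b * \<epsilon>\<^sup>2)" using b by (simp add: divide_le_eq mult_ac)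
  \<comment> \<open>The negated claim has 16 where the estimate has 8, which is contradictory since
    \<open>b * \<epsilon>\<^sup>2\<close> is positive.\<close>
  moreover have "b * (16 * \<epsilon>\<^sup>2) < \<delta>\<^sup>2"
    using contra \<epsilon>(1) by (simp add: b_def power_divide power_mult_distrib less_divide_eq)
  moreover have "b * \<epsilon>\<^sup>2 > 0" using b \<epsilon>(1) by simp
  ultimately show False by linarith
qed

text \<open>Pigeonhole: the fibres of \<open>g\<close> partition \<open>M\<close>, so not all of
  them can have \<open>q\<close> or more elements.\<close>

lemma exists_small_fibre:
  fixes q :: real and g :: "'a \<Rightarrow> 'n::finite"
  assumes "finite M" and "real (card M) < real CARD('n) * q"
  shows "\<exists>j. real (card {i\<in>M. g i = j}) < q"
proof (rule ccontr)
  assume "\<not> ?thesis"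
  then have "(\<Sum>j\<in>(UNIV::'n set). q) \<le> (\<Sum>j\<in>UNIV. real (card {i\<in>M. g i = j}))"
    by (intro sum_mono) (simp add: not_less)
  also have "\<dots> = real (\<Sum>j\<in>UNIV. card {i\<in>M. g i = j})" by simp
  also have "(\<Sum>j\<in>UNIV. card {i\<in>M. g i = j}) = card M"
    using sum.group[OF assms(1), of UNIV g "\<lambda>_. 1::nat"] by simp
  finally show False using assms(2) by simp
qed

section \<open>Assembly of the body, the decomposition and the lower bound\<close>

theorem theorem1p8:
  fixes \<epsilon> \<delta> :: real
  assumes "CARD('n::finite) > 2"
    and "0 < \<epsilon>" and "\<epsilon> < 1/2"
    and "0 < \<delta>" and "\<delta> < sqrt (real CARD('n) / 2 - 1)"
  shows "\<exists>(K :: (real ^ 'n) set) (m :: nat) (u :: nat \<Rightarrow> real ^ 'n) (v :: nat \<Rightarrow> real ^ 'n).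
    convex_body K \<and> origin_symmetric K \<and> K \<subseteq> cube \<and>
    BM_dist_ball K = sqrt (1 + \<delta>\<^sup>2) \<and>
    is_max_volume_ellipsoid (cball 0 1) K \<and>
    m > 0 \<and>
    (\<forall>i\<in>{1..m}. u i \<in> frontier K \<inter> frontier cube) \<and>
    (\<forall>i\<in>{1..m}. v i \<in> frontier (polar K) \<inter> frontier (polar cube)) \<and>
    (\<exists>\<alpha> :: nat \<Rightarrow> real. (\<forall>i\<in>{1..m}. \<alpha> i > 0) \<and> (\<Sum>i=1..m. \<alpha> i) = 1 \<and>
       (\<forall>x. (1 / real CARD('n)) *\<^sub>R x = (\<Sum>i=1..m. \<alpha> i *\<^sub>R (u i \<otimes>\<^sub>o v i) x))) \<and>
    (\<forall>M (\<beta> :: nat \<Rightarrow> real). M \<subseteq> {1..m} \<and>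
       onorm (\<lambda>x. (\<Sum>i\<in>M. \<beta> i *\<^sub>R (u i \<otimes>\<^sub>o v i) x) - x) \<le> \<epsilon> \<longrightarrow>
       real (card M) \<ge> real CARD('n) * min (real CARD('n) / 4) ((\<delta> / (4 * \<epsilon>))\<^sup>2))"
proof -
  define d where "d = CARD('n)"
  \<comment> \<open>Sylvester matrices have order a power of two; the largest one up to
    \<open>d\<close> exceeds \<open>d / 2\<close>, as the counting bound requires.\<close>
  obtain p where p: "2 ^ p \<le> d" "d < 2 * 2 ^ p"
    using ex_power_ivl1[of 2 d] assms(1) by (auto simp: d_def)
  define N :: nat where "N = 2 ^ p"
  have N: "N \<ge> 2" "N \<le> d" "real d < 2 * real N"
    using p assms(1) unfolding N_def d_def by linarith+
  \<comment> \<open>With this scale, \<open>N - 1\<close> coordinates \<plusminus>\<open>t\<close>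
    form a vector of norm \<open>\<delta>\<close>.\<close>
  define t where "t = \<delta> / sqrt (real N - 1)"
  have t2: "t\<^sup>2 * (real N - 1) = \<delta>\<^sup>2"
    using N(1) by (simp add: t_def power_divide)
  have "\<delta>\<^sup>2 < (sqrt (real d / 2 - 1))\<^sup>2"
    using assms(4,5) unfolding d_def by (intro power_strict_mono) auto
  then have \<delta>d: "\<delta>\<^sup>2 < real d / 2 - 1" using assms(1) by (simp add: d_def)
  \<comment> \<open>The upper bound on \<open>\<delta>\<close> enters here:
    \<open>\<delta>\<^sup>2 < d / 2 - 1 < N - 1\<close>, so the contact points fit into the
    cube.\<close>
  have "\<delta> \<le> sqrt (real N - 1)" using \<delta>d N by (intro real_le_rsqrt) simp
  then have t: "\<bar>t\<bar> \<le> 1" using assms(4) N(1) by (simp add: t_def)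
  define r where "r = sqrt (1 + \<delta>\<^sup>2)"
  have r: "1 \<le> r" "r \<le> sqrt (real CARD('n))" using \<delta>d by (auto simp: r_def d_def)
  define K :: "(real ^ 'n) set" where "K = cube \<inter> cball 0 r"
  have ballK: "cball 0 1 \<subseteq> K" using cball_subset_cube r(1) by (auto simp: K_def)
  have Kcube: "K \<subseteq> cube" by (simp add: K_def)

  obtain w :: "'n \<Rightarrow> nat \<Rightarrow> real ^ 'n" where
    w: "\<And>j k. k < N \<Longrightarrow> w j k \<in> cube" "\<And>j k. k < N \<Longrightarrow> w j k $ j = 1" and
    norm_w: "\<And>j B \<beta> c. B \<subseteq> {..<N} \<Longrightarrow> (norm ((\<Sum>k\<in>B. \<beta> k *\<^sub>R w j k) - c *\<^sub>R axis j 1))\<^sup>2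
       = (sum \<beta> B - c)\<^sup>2 + t\<^sup>2 * (real N * (\<Sum>k\<in>B. (\<beta> k)\<^sup>2) - (sum \<beta> B)\<^sup>2)"
  proof -
    define P where "P j u \<longleftrightarrow> (\<forall>k<N. u k \<in> cube \<and> u k $ j = 1) \<and>
      (\<forall>B \<beta> c. B \<subseteq> {..<N} \<longrightarrow> (norm ((\<Sum>k\<in>B. \<beta> k *\<^sub>R u k) - c *\<^sub>R axis j 1))\<^sup>2
         = (sum \<beta> B - c)\<^sup>2 + t\<^sup>2 * (real N * (\<Sum>k\<in>B. (\<beta> k)\<^sup>2) - (sum \<beta> B)\<^sup>2))"
      for j and u :: "nat \<Rightarrow> real ^ 'n"
    have "\<exists>u. P j u" for j
      using sylvester_vectors_exist[OF p(1)[unfolded d_def] t, of j] by (simp add: P_def N_def)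
    then obtain w where "\<And>j. P j (w j)" by metis
    then show ?thesis by (intro that[of w]) (simp_all add: P_def)
  qed
  have wK: "w j k \<in> K" if "k < N" for j k
  proof -
    \<comment> \<open>A single weight 1 with \<open>c = 0\<close> gives the squared norm
      \<open>1 + t\<^sup>2 * (N - 1)\<close>.\<close>
    have "(norm (w j k))\<^sup>2 = 1 + \<delta>\<^sup>2"
      using norm_w[of "{k}" "\<lambda>_. 1" j 0] that t2 by simp
    then have "norm (w j k) = r" unfolding r_def by (metis norm_ge_zero real_sqrt_unique)
    then show ?thesis using w(1)[OF that] by (simp add: K_def)
  qed
  \<comment> \<open>With all weights 1 and \<open>c = N\<close> the norm formula gives 0: the
    simplex is centered at the origin.\<close>
  have sum_w: "(\<Sum>k<N. w j k) = real N *\<^sub>R axis j 1" for j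
    using norm_w[of "{..<N}" "\<lambda>_. 1" j "real N"] by (simp add: power2_eq_square)

  \<comment> \<open>The index \<open>i\<close> enumerates all pairs of a coordinate \<open>j\<close>
    and a vertex \<open>k\<close>, with equal weights \<open>1 / m\<close>.\<close>
  define m where "m = d * N"
  have m: "m > 0" using N assms(1) by (simp add: m_def d_def)
  have "card ((UNIV :: 'n set) \<times> {..<N}) = m" by (simp add: m_def d_def card_cartesian_product)
  then obtain e :: "nat \<Rightarrow> 'n \<times> nat" where e: "bij_betw e {1..m} (UNIV \<times> {..<N})"
    using ex_bij_betw_nat_finite_1[of "(UNIV :: 'n set) \<times> {..<N}"] by auto
  have snd_e: "snd (e i) < N" if "i \<in> {1..m}" for i
    using bij_betwE[OF e] that by (metis lessThan_iff mem_Times_iff)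
  define u where "u i = w (fst (e i)) (snd (e i))" for i
  define v :: "nat \<Rightarrow> real ^ 'n" where "v i = axis (fst (e i)) 1" for i
  define \<alpha> :: "nat \<Rightarrow> real" where "\<alpha> i = 1 / real m" for i

  have u: "u i \<in> frontier K \<inter> frontier cube" if "i \<in> {1..m}" for i
    using snd_e[OF that] w wK in_frontier_if_component_1[OF Kcube] in_frontier_if_component_1[OF order_refl]
    unfolding u_def by (metis IntI)
  have v: "v i \<in> frontier (polar K) \<inter> frontier (polar cube)" for i
  proof -
    have "v i \<in> K" using ballK by (auto simp: v_def)
    then show ?thesis
      using Kcube axis_in_frontier_polar[OF Kcube] axis_in_frontier_polar[OF order_refl]
      unfolding v_def by blast
  qed

  \<comment> \<open>For fixed \<open>j\<close> the vectors \<open>w j k\<close> average to the axis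
    vector, so the sum reduces to the expansion of \<open>x\<close> in the standard basis.\<close>
  have decomp: "(1 / real CARD('n)) *\<^sub>R x = (\<Sum>i=1..m. \<alpha> i *\<^sub>R (u i \<otimes>\<^sub>o v i) x)" for x
  proof -
    have "(\<Sum>i=1..m. \<alpha> i *\<^sub>R (u i \<otimes>\<^sub>o v i) x)
        = (\<Sum>i=1..m. (\<lambda>(j, k). ((w j k \<bullet> x) / real m) *\<^sub>R axis j 1) (e i))"
      by (simp add: \<alpha>_def tensor_op_def u_def v_def case_prod_beta)
    also have "\<dots> = (\<Sum>(j, k)\<in>UNIV \<times> {..<N}. ((w j k \<bullet> x) / real m) *\<^sub>R axis j 1)"
      by (rule sum.reindex_bij_betw[OF e])
    also have "\<dots> = (\<Sum>j\<in>UNIV. (((\<Sum>k<N. w j k) \<bullet> x) / real m) *\<^sub>R axis j 1)"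
      by (simp add: inner_sum_left sum_divide_distrib scaleR_sum_left flip: sum.cartesian_product)
    also have "\<dots> = (\<Sum>j\<in>UNIV. (1 / real d) *\<^sub>R (x $ j *s axis j 1))"
      using N(1) by (intro sum.cong) (simp_all add: sum_w inner_axis' m_def scalar_mult_eq_scaleR)
    also have "\<dots> = (1 / real d) *\<^sub>R x"
      by (simp add: basis_expansion flip: scaleR_sum_right)
    finally show ?thesis by (simp add: d_def)
  qed

  have large: "real (card M) \<ge> real CARD('n) * min (real CARD('n) / 4) ((\<delta> / (4 * \<epsilon>))\<^sup>2)"
    if M: "M \<subseteq> {1..m}" and on: "onorm (\<lambda>x. (\<Sum>i\<in>M. \<beta> i *\<^sub>R (u i \<otimes>\<^sub>o v i) x) - x) \<le> \<epsilon>"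
    for M and \<beta> :: "nat \<Rightarrow> real"
  proof (rule ccontr)
    assume few: "\<not> ?thesis"
    have finM: "finite M" using M finite_subset by blast
    obtain j where "real (card {i\<in>M. fst (e i) = j}) < min (real CARD('n) / 4) ((\<delta> / (4 * \<epsilon>))\<^sup>2)"
      using exists_small_fibre[OF finM few[unfolded not_le], of "\<lambda>i. fst (e i)"] by blast
    moreover define F where "F = {i\<in>M. fst (e i) = j}"
    ultimately have small: "real (card F) < min (real d / 4) ((\<delta> / (4 * \<epsilon>))\<^sup>2)" by (simp add: d_def)
    \<comment> \<open>\<open>z\<close> represents the \<open>j\<close>-th row of the operator minus
      the identity: only indices in \<open>F\<close> have a \<open>v i\<close> with nonzero
      \<open>j\<close>-th coordinate.\<close>
    define z where "z = (\<Sum>i\<in>F. \<beta> i *\<^sub>R u i) - axis j 1"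
    define T where "T = (\<lambda>x. (\<Sum>i\<in>M. \<beta> i *\<^sub>R (u i \<otimes>\<^sub>o v i) x) - x)"
    have "bounded_linear T"
      unfolding T_def tensor_op_def by (intro bounded_linear_intros)
    have "T x $ j = z \<bullet> x" for x
    proof -
      have "(\<Sum>i\<in>M. \<beta> i * (u i \<bullet> x) * v i $ j) = (\<Sum>i\<in>F. \<beta> i * (u i \<bullet> x))"
        unfolding F_def sum.inter_filter[OF finM] by (intro sum.cong) (auto simp: v_def axis_def)
      then show ?thesis
        by (simp add: T_def tensor_op_def z_def inner_diff_left inner_sum_left inner_axis' mult.assoc)
    qed
    \<comment> \<open>Testing the operator at \<open>z\<close> itself bounds the norm of its row by
      the operator norm.\<close>
    then have "(norm z)\<^sup>2 = T z $ j" by (simp add: power2_norm_eq_inner)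
    also have "\<dots> \<le> norm (T z)" using component_le_norm_cart[of "T z" j] by linarith
    also have "\<dots> \<le> onorm T * norm z" by (rule onorm[OF \<open>bounded_linear T\<close>])
    also have "\<dots> \<le> \<epsilon> * norm z" using on by (intro mult_right_mono) (auto simp: T_def)
    finally have "norm z \<le> \<epsilon>" using assms(2) by (cases "z = 0") (auto simp: power2_eq_square)
    then have z: "(norm z)\<^sup>2 \<le> \<epsilon>\<^sup>2" by (intro power_mono) auto

    \<comment> \<open>The weights are moved from indices \<open>i\<close> to vertices
      \<open>k\<close>; this is faithful because on \<open>F\<close> the first component of
      \<open>e i\<close> is always \<open>j\<close>.\<close>
    define B where "B = (\<lambda>i. snd (e i)) ` F"
    define \<gamma> where "\<gamma> k = \<beta> (inv_into {1..m} e (j, k))" for k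
    have F: "F \<subseteq> {1..m}" using M by (auto simp: F_def)
    then have B: "B \<subseteq> {..<N}" using snd_e by (auto simp: B_def)
    have inj_e: "inj_on e {1..m}" using e by (rule bij_betw_imp_inj_on)
    have inj: "inj_on (\<lambda>i. snd (e i)) F"
    proof (rule inj_onI)
      fix i i' assume i: "i \<in> F" "i' \<in> F" "snd (e i) = snd (e i')"
      then have "e i = e i'" by (simp add: F_def prod_eq_iff)
      then show "i = i'" using inj_e F i by (auto dest: inj_onD)
    qed
    have \<gamma>: "\<gamma> (snd (e i)) = \<beta> i" if "i \<in> F" for i
    proof -
      have "(j, snd (e i)) = e i" using that by (auto simp: F_def)
      then show ?thesis using inv_into_f_f[OF inj_e, of i] F that by (auto simp: \<gamma>_def)
    qed
    have "(\<Sum>k\<in>B. \<gamma> k *\<^sub>R w j k) = (\<Sum>i\<in>F. \<beta> i *\<^sub>R u i)"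
      unfolding B_def sum.reindex[OF inj] by (intro sum.cong) (auto simp: \<gamma> u_def F_def)
    then have "z = (\<Sum>k\<in>B. \<gamma> k *\<^sub>R w j k) - 1 *\<^sub>R axis j 1" by (simp add: z_def)
    with z have "(sum \<gamma> B - 1)\<^sup>2 + t\<^sup>2 * (real N * (\<Sum>k\<in>B. (\<gamma> k)\<^sup>2) - (sum \<gamma> B)\<^sup>2) \<le> \<epsilon>\<^sup>2"
      using norm_w[OF B, of \<gamma> j 1] by simp
    then have "real (card B) \<ge> min (real d / 4) ((\<delta> / (4 * \<epsilon>))\<^sup>2)"
      using N B assms(2,3) t2 by (intro simplex_deviation_card_bound) (auto intro: finite_subset)
    moreover have "card B = card F" unfolding B_def by (rule card_image[OF inj])
    ultimately show False using small by simp
  qed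

  have "convex_body K" unfolding K_def by (rule convex_body_cube_Int_cball[OF r(1)])
  moreover have "origin_symmetric K"
  proof -
    have "- x \<in> K" if "x \<in> K" for x using that by (auto simp: K_def cube_def minus_le_iff)
    then show ?thesis unfolding origin_symmetric_def by (force intro: image_eqI[of _ _ "- _"])
  qed
  moreover have "BM_dist_ball K = sqrt (1 + \<delta>\<^sup>2)"
    unfolding K_def using BM_dist_ball_cube_Int_cball[OF r] by (simp add: r_def)
  moreover have "is_max_volume_ellipsoid (cball 0 1) K"
    by (rule is_max_volume_ellipsoid_cball[OF ballK Kcube])
  moreover have "(\<forall>i\<in>{1..m}. \<alpha> i > 0) \<and> (\<Sum>i=1..m. \<alpha> i) = 1"
    using m by (simp add: \<alpha>_def)
  ultimately show ?thesis
    using Kcube m u v decomp large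
    by (intro exI[of _ K] exI[of _ m] exI[of _ u] exI[of _ v] conjI exI[of _ \<alpha>]) auto
qed

end
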